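(* In the timed process algebra T-AWN, let $P$ be a state of a parallel process. Write $P\xrightarrow{\mathbf{rcv}}$ if $P\xrightarrow{\mathbf{receive}(m)}$ for some $m$, and $P\xrightarrow{\mathbf{send}}$ if $P\xrightarrow{\mathbf{send}(m)}$ for some $m$. Write $P\xrightarrow{\mathbf{inb}}$ if $P\xrightarrow{a}$ for some instantaneous non-blocking action $a$, i.e. $a$ of the form $R{:}\mathbf{*cast}(m)$, $\mathbf{deliver}(d)$ or $\tau$. Then: 1. ($P\xrightarrow{\mathrm{w}}$ or $P\xrightarrow{R:\mathrm{w}}$ for some $R\subseteq\mathrm{IP}$) iff $P\not\xrightarrow{\mathbf{rcv}}\wedge P\not\xrightarrow{\mathbf{send}}\wedge P\not\xrightarrow{\mathbf{inb}}$. 2. ($P\xrightarrow{\mathrm{wr}}$ or $P\xrightarrow{R:\mathrm{wr}}$ for some $R$) iff $P\xrightarrow{\mathbf{rcv}}\wedge P\not\xrightarrow{\mathbf{send}}\wedge P\not\xrightarrow{\mathbf{inb}}$. 3. ($P\xrightarrow{\mathrm{ws}}$ or $P\xrightarrow{R:\mathrm{ws}}$ for some $R$) iff $P\not\xrightarrow{\mathbf{rcv}}\wedge P\xrightarrow{\mathbf{send}}\wedge P\not\xrightarrow{\mathbf{inb}}$. 4. ($P\xrightarrow{\mathrm{wrs}}$ or $P\xrightarrow{R:\mathrm{wrs}}$ for some $R$) iff $P\xrightarrow{\mathbf{rcv}}\wedge P\xrightarrow{\mathbf{send}}\wedge P\not\xrightarrow{\mathbf{inb}}$.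
   Context: $P\xrightarrow{a}$ means that there exists $P'$ with $P\xrightarrow{a}P'$. The auxiliary construct $\mathbf{*cast}$ never occurs inside a $+$-context. Sequential level. A data structure is fixed with types including TIME (integers, together with $\infty$), DATA, MSG, IP and $\mathcal{P}(\mathrm{IP})$, and with data expressions and first-order formulas over it (partial functions are allowed; an atomic formula containing an undefined subterm is false). A valuation $\xi$ is a partial map from variables to values; $\xi(e)\!\downarrow$ means that $e$ is defined under $\xi$. $\xi[\mathtt{var}:=v]$ updates $\xi$ at $\mathtt{var}$; $\emptyset$ is the empty valuation. $\mathtt{now}$ is a distinguished TIME variable and $\xi[\mathtt{now}{+}{+}]:=\xi[\mathtt{now}:=\xi(\mathtt{now})+1]$. Each process name $X$ has a defining equation $X(\mathtt{var}_1,\dots,\mathtt{var}_n)\stackrel{def}{=}p$ with $p$ guarded, i.e. every call of a process name in $p$ occurs inside a subexpression $[\varphi]q$, $[\![\mathtt{var}:=e]\!]q$, $\alpha.q$ or $\mathbf{unicast}(dest,ms).q\blacktriangleright r$. Sequential expressions: $SP::=X(e_1,\dots,e_n)\mid[\varphi]SP\mid[\![\mathtt{var}:=e]\!]SP\mid SP+SP\mid\alpha.SP\mid\mathbf{unicast}(dest,ms).SP\blacktriangleright SP\mid\mathbf{*cast}_{dsts}(m)[n,o].SP\blacktriangleright SP$, with $\alpha::=\mathbf{broadcast}(ms)\mid\mathbf{groupcast}(dests,ms)\mid\mathbf{send}(ms)\mid\mathbf{deliver}(data)\mid\mathbf{receive}(\mathtt{msg})$. Constants $LB,LG,LU>0$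 and $\Delta B,\Delta G,\Delta U\ge0$ are fixed. Actions are $\tau$, $R{:}\mathbf{*cast}(m)$, $\mathbf{send}(m)$, $\mathbf{deliver}(d)$, $\mathbf{receive}(m)$, wait actions in $\mathcal{W}=\{\mathrm{w},\mathrm{wr},\mathrm{ws},\mathrm{wrs}\}$, and transmission actions $R{:}w_1$ ($R\subseteq\mathrm{IP}$, $w_1\in\mathcal{W}$). Join $\wedge$ on $\mathcal{W}$: $\mathrm{w}$ is neutral, $x\wedge x=x$, $\mathrm{wr}\wedge\mathrm{ws}=\mathrm{ws}\wedge\mathrm{wr}=\mathrm{wrs}$, and $\mathrm{wrs}\wedge x=x\wedge\mathrm{wrs}=\mathrm{wrs}$. Sequential rules (least relation): - $\xi,\mathbf{broadcast}(ms).p\xrightarrow{\tau}\xi,\mathbf{*cast}_{\mathrm{IP}}(\xi(ms))[LB,\Delta B].p\blacktriangleright p$; likewise groupcast to $\mathbf{*cast}_{\xi(dests)}(\xi(ms))[LG,\Delta G].p\blacktriangleright p$; and $\xi,\mathbf{unicast}(dest,ms).p\blacktriangleright q\xrightarrow{\tau}\xi,\mathbf{*cast}_{\{\xi(dest)\}}(\xi(ms))[LU,\Delta U].p\blacktriangleright q$ (all when the expressions are defined). - For all $R\subseteq\mathrm{IP}$: $\xi,\mathbf{*cast}_{dsts}(m)[n{+}1,o].p\blacktriangleright q\xrightarrow{R:\mathrm{w}}\xi[\mathtt{now}{+}{+}],\mathbf{*cast}_{dsts\cap R}(m)[n,o].p\blacktriangleright q$ and $\xi,\mathbf{*cast}_{dsts}(m)[n{+}1,o{+}1].p\blacktriangleright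 q\xrightarrow{R:\mathrm{w}}\xi[\mathtt{now}{+}{+}],\mathbf{*cast}_{dsts\cap R}(m)[n{+}1,o].p\blacktriangleright q$. - $\xi,\mathbf{*cast}_{dsts}(m)[0,o].p\blacktriangleright q\xrightarrow{dsts:\mathbf{*cast}(m)}\xi,p$ if $dsts\ne\emptyset$, and $\to\xi,q$ otherwise. - If $\xi(ms)\!\downarrow$: $\xi,\mathbf{send}(ms).p\xrightarrow{\mathbf{send}(\xi(ms))}\xi,p$ and $\xi,\mathbf{send}(ms).p\xrightarrow{\mathrm{ws}}\xi[\mathtt{now}{+}{+}],\mathbf{send}(ms).p$. - $\xi,\mathbf{deliver}(data).p\xrightarrow{\mathbf{deliver}(\xi(data))}\xi,p$ if defined. - $\xi,\mathbf{receive}(\mathtt{msg}).p\xrightarrow{\mathbf{receive}(m)}\xi[\mathtt{msg}:=m],p$ for all $m$, and $\xi,\mathbf{receive}(\mathtt{msg}).p\xrightarrow{\mathrm{wr}}\xi[\mathtt{now}{+}{+}],\mathbf{receive}(\mathtt{msg}).p$. - $\xi,[\![\mathtt{var}:=e]\!]p\xrightarrow{\tau}\xi[\mathtt{var}:=\xi(e)],p$ if defined. - $\xi,r\xrightarrow{\mathrm{w}}\xi[\mathtt{now}{+}{+}],r$ if $r$ is a broadcast, groupcast, unicast, send, deliver, assignment or process call whose argument expression(s) are undefined under $\xi$. - Recursion: with $X(\vec{\mathtt{var}})\stackrel{def}{=}p$, all $\xi(e_i)\!\downarrow$ and $\emptyset[\mathtt{var}_i:=\xi(e_i)],p\xrightarrow{a}\zeta,p'$: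 if $a\notin\mathcal{W}$, then $\xi,X(\vec e)\xrightarrow{a}\zeta,p'$; if $a=w_1\in\mathcal{W}$, then $\xi,X(\vec e)\xrightarrow{w_1}\xi[\mathtt{now}{+}{+}],X(\vec e)$. - $\xi,[\varphi]p\xrightarrow{\tau}\zeta,p$ for each extension $\zeta$ of $\xi$ to the free variables of $\varphi$ satisfying $\varphi$; if none exists, $\xi,[\varphi]p\xrightarrow{\mathrm{w}}\xi[\mathtt{now}{+}{+}],[\varphi]p$. - If $\xi,p\xrightarrow{a}\zeta,p'$ with $a\notin\mathcal{W}$, then both $\xi,p+q$ and $\xi,q+p$ have $\xrightarrow{a}\zeta,p'$; if $\xi,p\xrightarrow{w_1}\zeta,p'$ and $\xi,q\xrightarrow{w_2}\zeta,q'$, then $\xi,p+q\xrightarrow{w_1\wedge w_2}\zeta,p'+q'$. Parallel level: $PP::=\xi,SP\mid PP\langle\!\langle PP$. The partial function $\langle\!\langle$ on $\mathcal{W}$ (left argument from $P$, right from $Q$) is: - $\mathrm{w}\langle\!\langle(\mathrm{w},\mathrm{wr},\mathrm{ws},\mathrm{wrs})=(\mathrm{w},\mathrm{wr},\mathrm{w},\mathrm{wr})$; - $\mathrm{wr}\langle\!\langle(\mathrm{w},\mathrm{wr})=(\mathrm{w},\mathrm{wr})$, and undefined for $\mathrm{ws},\mathrm{wrs}$; - $\mathrm{ws}\langle\!\langle(\mathrm{w},\mathrm{wr},\mathrm{ws},\mathrm{wrs})=(\mathrm{ws},\mathrm{wrs},\mathrm{ws},\mathrm{wrs})$; - $\mathrm{wrs}\langle\!\langle(\mathrm{w},\mathrm{wr})=(\mathrm{ws},\mathrm{wrs})$,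 and undefined for $\mathrm{ws},\mathrm{wrs}$. Parallel rules: - If $P\xrightarrow{a}P'$ with $a$ not a receive action, not in $\mathcal{W}$ and not of the form $R{:}w_1$, then $P\langle\!\langle Q\xrightarrow{a}P'\langle\!\langle Q$. - If $Q\xrightarrow{a}Q'$ with $a$ not a send action, not in $\mathcal{W}$ and not of the form $R{:}w_1$, then $P\langle\!\langle Q\xrightarrow{a}P\langle\!\langle Q'$. - If $P\xrightarrow{\mathbf{receive}(m)}P'$ and $Q\xrightarrow{\mathbf{send}(m)}Q'$, then $P\langle\!\langle Q\xrightarrow{\tau}P'\langle\!\langle Q'$. - If $P\xrightarrow{x}P'$ and $Q\xrightarrow{y}Q'$, where each of $x,y$ is a wait action or a transmission action with the underlying wait actions $w_1,w_2$ and $w_3=w_1\langle\!\langle w_2$ defined, then $P\langle\!\langle Q$ does a transition to $P'\langle\!\langle Q'$ labelled $w_3$ if both are wait actions, and labelled $R{:}w_3$ if at least one is a transmission action $R{:}\cdot$ (and if both are transmission actions they must carry the same $R$).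
   Formalization: That *cast never occurs inside a + is read up to unfolding of called process names, at any depth; read only syntactically the claim fails: with X defined as a *cast, X + receive(x).q does both R:w and receive(m). An undefined now stays undefined when time passes. *)

theory Defs
  imports Main
begin

section \<open>Data\<close>

datatype time = Fin int | Infinity

fun next_time :: "time \<Rightarrow> time" where
  "next_time (Fin i) = Fin (i + 1)"
| "next_time Infinity = Infinity"

text \<open>The type variable \<open>'s\<close> indexes the types of the data structure other than the five
  mandatory ones; \<open>'o\<close> is the union of all their elements. MSG, DATA and IP are the
  HOL types \<open>'m\<close>, \<open>'d\<close> and \<open>'i\<close>.\<close>

datatype 's sort = TIME | DATA | MSG | IP | IPS | Other 's

datatype ('d, 'm, 'i, 'o) val =
  VTime time | VData 'd | VMsg 'm | VIP 'i | VIPs "'i set" | VOther 'o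

type_synonym ('x, 'd, 'm, 'i, 'o) valuation = "'x \<Rightarrow> ('d, 'm, 'i, 'o) val option"

datatype ('x, 'f) exp = Var 'x | Fun 'f "('x, 'f) exp list"

datatype ('x, 'f, 'p) form =
    Atom 'p "('x, 'f) exp list"
  | Equal "('x, 'f) exp" "('x, 'f) exp"
  | Neg "('x, 'f, 'p) form"
  | Conj "('x, 'f, 'p) form" "('x, 'f, 'p) form"
  | Disj "('x, 'f, 'p) form" "('x, 'f, 'p) form"
  | Impl "('x, 'f, 'p) form" "('x, 'f, 'p) form"
  | All 'x "('x, 'f, 'p) form"
  | Exi 'x "('x, 'f, 'p) form"

record ('x, 'f, 'p, 's, 'd, 'm, 'i, 'o) data_structure =
  other_sort :: "'o \<Rightarrow> 's"
  var_sort :: "'x \<Rightarrow> 's sort"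
  now :: 'x
  fun_args :: "'f \<Rightarrow> 's sort list"
  fun_res :: "'f \<Rightarrow> 's sort"
  fun_interp :: "'f \<Rightarrow> ('d, 'm, 'i, 'o) val list \<Rightarrow> ('d, 'm, 'i, 'o) val option"
  pred_args :: "'p \<Rightarrow> 's sort list"
  pred_interp :: "'p \<Rightarrow> ('d, 'm, 'i, 'o) val list \<Rightarrow> bool"

primrec val_sort ::
  "('x, 'f, 'p, 's, 'd, 'm, 'i, 'o, 'z) data_structure_scheme \<Rightarrow> ('d, 'm, 'i, 'o) val \<Rightarrow> 's sort"
where
  "val_sort D (VTime t) = TIME"
| "val_sort D (VData d) = DATA"
| "val_sort D (VMsg m) = MSG"
| "val_sort D (VIP i) = IP"
| "val_sort D (VIPs I) = IPS"
| "val_sort D (VOther v) = Other (other_sort D v)"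

definition wf_data :: "('x, 'f, 'p, 's, 'd, 'm, 'i, 'o, 'z) data_structure_scheme \<Rightarrow> bool" where
  "wf_data D \<longleftrightarrow> var_sort D (now D) = TIME \<and>
     (\<forall>f vs v. map (val_sort D) vs = fun_args D f \<longrightarrow> fun_interp D f vs = Some v \<longrightarrow>
        val_sort D v = fun_res D f)"

definition wf_valuation ::
  "('x, 'f, 'p, 's, 'd, 'm, 'i, 'o, 'z) data_structure_scheme \<Rightarrow>
   ('x, 'd, 'm, 'i, 'o) valuation \<Rightarrow> bool"
where
  "wf_valuation D \<xi> \<longleftrightarrow> (\<forall>x v. \<xi> x = Some v \<longrightarrow> val_sort D v = var_sort D x)"

inductive has_sort ::
  "('x, 'f, 'p, 's, 'd, 'm, 'i, 'o, 'z) data_structure_scheme \<Rightarrow> ('x, 'f) exp \<Rightarrow> 's sort \<Rightarrow> bool"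
  for D
where
  "has_sort D (Var x) (var_sort D x)"
| "list_all2 (has_sort D) es (fun_args D f) \<Longrightarrow> has_sort D (Fun f es) (fun_res D f)"

primrec wf_form ::
  "('x, 'f, 'p, 's, 'd, 'm, 'i, 'o, 'z) data_structure_scheme \<Rightarrow> ('x, 'f, 'p) form \<Rightarrow> bool"
where
  "wf_form D (Atom p es) \<longleftrightarrow> list_all2 (has_sort D) es (pred_args D p)"
| "wf_form D (Equal e1 e2) \<longleftrightarrow> (\<exists>s. has_sort D e1 s \<and> has_sort D e2 s)"
| "wf_form D (Neg \<phi>) \<longleftrightarrow> wf_form D \<phi>"
| "wf_form D (Conj \<phi> \<psi>) \<longleftrightarrow> wf_form D \<phi> \<and> wf_form D \<psi>"
| "wf_form D (Disj \<phi> \<psi>) \<longleftrightarrow> wf_form D \<phi> \<and> wf_form D \<psi>"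
| "wf_form D (Impl \<phi> \<psi>) \<longleftrightarrow> wf_form D \<phi> \<and> wf_form D \<psi>"
| "wf_form D (All x \<phi>) \<longleftrightarrow> wf_form D \<phi>"
| "wf_form D (Exi x \<phi>) \<longleftrightarrow> wf_form D \<phi>"

primrec fv_exp :: "('x, 'f) exp \<Rightarrow> 'x set" where
  "fv_exp (Var x) = {x}"
| "fv_exp (Fun f es) = \<Union> (set (map fv_exp es))"

primrec fv_form :: "('x, 'f, 'p) form \<Rightarrow> 'x set" where
  "fv_form (Atom p es) = \<Union> (set (map fv_exp es))"
| "fv_form (Equal e1 e2) = fv_exp e1 \<union> fv_exp e2"
| "fv_form (Neg \<phi>) = fv_form \<phi>"
| "fv_form (Conj \<phi> \<psi>) = fv_form \<phi> \<union> fv_form \<psi>"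
| "fv_form (Disj \<phi> \<psi>) = fv_form \<phi> \<union> fv_form \<psi>"
| "fv_form (Impl \<phi> \<psi>) = fv_form \<phi> \<union> fv_form \<psi>"
| "fv_form (All x \<phi>) = fv_form \<phi> - {x}"
| "fv_form (Exi x \<phi>) = fv_form \<phi> - {x}"

primrec eval ::
  "('x, 'f, 'p, 's, 'd, 'm, 'i, 'o, 'z) data_structure_scheme \<Rightarrow>
   ('x, 'd, 'm, 'i, 'o) valuation \<Rightarrow> ('x, 'f) exp \<Rightarrow> ('d, 'm, 'i, 'o) val option"
where
  "eval D \<xi> (Var x) = \<xi> x"
| "eval D \<xi> (Fun f es) = Option.bind (those (map (eval D \<xi>) es)) (fun_interp D f)"

primrec sat ::
  "('x, 'f, 'p, 's, 'd, 'm, 'i, 'o, 'z) data_structure_scheme \<Rightarrow>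
   ('x, 'd, 'm, 'i, 'o) valuation \<Rightarrow> ('x, 'f, 'p) form \<Rightarrow> bool"
where
  "sat D \<xi> (Atom p es) \<longleftrightarrow> (\<exists>vs. those (map (eval D \<xi>) es) = Some vs \<and> pred_interp D p vs)"
| "sat D \<xi> (Equal e1 e2) \<longleftrightarrow> (\<exists>v. eval D \<xi> e1 = Some v \<and> eval D \<xi> e2 = Some v)"
| "sat D \<xi> (Neg \<phi>) \<longleftrightarrow> \<not> sat D \<xi> \<phi>"
| "sat D \<xi> (Conj \<phi> \<psi>) \<longleftrightarrow> sat D \<xi> \<phi> \<and> sat D \<xi> \<psi>"
| "sat D \<xi> (Disj \<phi> \<psi>) \<longleftrightarrow> sat D \<xi> \<phi> \<or> sat D \<xi> \<psi>"
| "sat D \<xi> (Impl \<phi> \<psi>) \<longleftrightarrow> (sat D \<xi> \<phi> \<longrightarrow> sat D \<xi> \<psi>)"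
| "sat D \<xi> (All x \<phi>) \<longleftrightarrow> (\<forall>v. val_sort D v = var_sort D x \<longrightarrow> sat D (\<xi>(x \<mapsto> v)) \<phi>)"
| "sat D \<xi> (Exi x \<phi>) \<longleftrightarrow> (\<exists>v. val_sort D v = var_sort D x \<and> sat D (\<xi>(x \<mapsto> v)) \<phi>)"

text \<open>Typed evaluation. On well-sorted expressions and valuations these are defined exactly
  when \<open>eval\<close> is.\<close>

definition eval_msg where
  "eval_msg D \<xi> e = (case eval D \<xi> e of Some (VMsg m) \<Rightarrow> Some m | _ \<Rightarrow> None)"

definition eval_data where
  "eval_data D \<xi> e = (case eval D \<xi> e of Some (VData d) \<Rightarrow> Some d | _ \<Rightarrow> None)"

definition eval_ip where
  "eval_ip D \<xi> e = (case eval D \<xi> e of Some (VIP i) \<Rightarrow> Some i | _ \<Rightarrow> None)"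

definition eval_ips where
  "eval_ips D \<xi> e = (case eval D \<xi> e of Some (VIPs I) \<Rightarrow> Some I | _ \<Rightarrow> None)"

text \<open>The body of a process call is run from the empty valuation, so \<open>now\<close> may be undefined;
  it then stays undefined when time passes, and time is not blocked.\<close>

definition tick ::
  "('x, 'f, 'p, 's, 'd, 'm, 'i, 'o, 'z) data_structure_scheme \<Rightarrow>
   ('x, 'd, 'm, 'i, 'o) valuation \<Rightarrow> ('x, 'd, 'm, 'i, 'o) valuation"
where
  "tick D \<xi> = \<xi>(now D :=
     (case \<xi> (now D) of Some (VTime t) \<Rightarrow> Some (VTime (next_time t)) | _ \<Rightarrow> None))"

definition guard_extension ::
  "('x, 'f, 'p, 's, 'd, 'm, 'i, 'o, 'z) data_structure_scheme \<Rightarrow>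
   ('x, 'd, 'm, 'i, 'o) valuation \<Rightarrow> ('x, 'f, 'p) form \<Rightarrow> ('x, 'd, 'm, 'i, 'o) valuation \<Rightarrow> bool"
where
  "guard_extension D \<xi> \<phi> \<zeta> \<longleftrightarrow>
     wf_valuation D \<zeta> \<and> \<xi> \<subseteq>\<^sub>m \<zeta> \<and> dom \<zeta> = dom \<xi> \<union> fv_form \<phi> \<and> sat D \<zeta> \<phi>"


section \<open>Sequential processes\<close>

datatype ('x, 'f) action_prefix =
    Broadcast "('x, 'f) exp"
  | Groupcast "('x, 'f) exp" "('x, 'f) exp"
  | Send "('x, 'f) exp"
  | Deliver "('x, 'f) exp"
  | Receive 'x

text \<open>In \<open>Unicast dest ms p q\<close> and \<open>Cast dsts m n l p q\<close>, \<open>p\<close> is the continuation on success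
  and \<open>q\<close> the alternative one.\<close>

datatype ('x, 'f, 'p, 'm, 'i, 'n) sp =
    Call 'n "('x, 'f) exp list"
  | Guard "('x, 'f, 'p) form" "('x, 'f, 'p, 'm, 'i, 'n) sp"
  | Assign 'x "('x, 'f) exp" "('x, 'f, 'p, 'm, 'i, 'n) sp"
  | Choice "('x, 'f, 'p, 'm, 'i, 'n) sp" "('x, 'f, 'p, 'm, 'i, 'n) sp"
  | Prefix "('x, 'f) action_prefix" "('x, 'f, 'p, 'm, 'i, 'n) sp"
  | Unicast "('x, 'f) exp" "('x, 'f) exp"
      "('x, 'f, 'p, 'm, 'i, 'n) sp" "('x, 'f, 'p, 'm, 'i, 'n) sp"
  | Cast "'i set" 'm nat nat "('x, 'f, 'p, 'm, 'i, 'n) sp" "('x, 'f, 'p, 'm, 'i, 'n) sp"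

record ('x, 'f, 'p, 's, 'd, 'm, 'i, 'o, 'n) tawn =
  "('x, 'f, 'p, 's, 'd, 'm, 'i, 'o) data_structure" +
  LB :: nat
  LG :: nat
  LU :: nat
  \<Delta>B :: nat
  \<Delta>G :: nat
  \<Delta>U :: nat
  params :: "'n \<Rightarrow> 'x list"
  body :: "'n \<Rightarrow> ('x, 'f, 'p, 'm, 'i, 'n) sp"

datatype wait = W | WR | WS | WRS

datatype ('d, 'm, 'i) action =
    Tau
  | ACast "'i set" 'm
  | ASend 'm
  | ADeliver 'd
  | AReceive 'm
  | AWait wait
  | ATrans "'i set" wait

definition wait_join :: "wait \<Rightarrow> wait \<Rightarrow> wait" where
  "wait_join x y = (if x = W then y else if y = W \<or> x = y then x else WRS)"

inductive seq_step ::
  "('x, 'f, 'p, 's, 'd, 'm, 'i, 'o, 'n) tawn \<Rightarrow>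
   ('x, 'd, 'm, 'i, 'o) valuation \<Rightarrow> ('x, 'f, 'p, 'm, 'i, 'n) sp \<Rightarrow>
   ('d, 'm, 'i) action \<Rightarrow>
   ('x, 'd, 'm, 'i, 'o) valuation \<Rightarrow> ('x, 'f, 'p, 'm, 'i, 'n) sp \<Rightarrow> bool"
  for T
where
  broadcast: "eval_msg T \<xi> ms = Some m \<Longrightarrow>
    seq_step T \<xi> (Prefix (Broadcast ms) p) Tau \<xi> (Cast UNIV m (LB T) (\<Delta>B T) p p)"
| groupcast: "eval_ips T \<xi> dests = Some I \<Longrightarrow> eval_msg T \<xi> ms = Some m \<Longrightarrow>
    seq_step T \<xi> (Prefix (Groupcast dests ms) p) Tau \<xi> (Cast I m (LG T) (\<Delta>G T) p p)"
| unicast: "eval_ip T \<xi> dest = Some i \<Longrightarrow> eval_msg T \<xi> ms = Some m \<Longrightarrow>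
    seq_step T \<xi> (Unicast dest ms p q) Tau \<xi> (Cast {i} m (LU T) (\<Delta>U T) p q)"

| cast_time: "seq_step T \<xi> (Cast dsts m (Suc n) l p q) (ATrans R W)
    (tick T \<xi>) (Cast (dsts \<inter> R) m n l p q)"
| cast_delay: "seq_step T \<xi> (Cast dsts m (Suc n) (Suc l) p q) (ATrans R W)
    (tick T \<xi>) (Cast (dsts \<inter> R) m (Suc n) l p q)"
| cast_success: "dsts \<noteq> {} \<Longrightarrow> seq_step T \<xi> (Cast dsts m 0 l p q) (ACast dsts m) \<xi> p"
| cast_failure: "dsts = {} \<Longrightarrow> seq_step T \<xi> (Cast dsts m 0 l p q) (ACast dsts m) \<xi> q"

| send: "eval_msg T \<xi> ms = Some m \<Longrightarrow> seq_step T \<xi> (Prefix (Send ms) p) (ASend m) \<xi> p"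
| send_wait: "eval_msg T \<xi> ms = Some m \<Longrightarrow>
    seq_step T \<xi> (Prefix (Send ms) p) (AWait WS) (tick T \<xi>) (Prefix (Send ms) p)"
| deliver: "eval_data T \<xi> data = Some d \<Longrightarrow>
    seq_step T \<xi> (Prefix (Deliver data) p) (ADeliver d) \<xi> p"
| receive: "seq_step T \<xi> (Prefix (Receive x) p) (AReceive m) (\<xi>(x \<mapsto> VMsg m)) p"
| receive_wait: "seq_step T \<xi> (Prefix (Receive x) p) (AWait WR) (tick T \<xi>) (Prefix (Receive x) p)"
| assign: "eval T \<xi> e = Some v \<Longrightarrow> seq_step T \<xi> (Assign x e p) Tau (\<xi>(x \<mapsto> v)) p"

| broadcast_undef: "eval_msg T \<xi> ms = None \<Longrightarrow> r = Prefix (Broadcast ms) p \<Longrightarrow>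
    seq_step T \<xi> r (AWait W) (tick T \<xi>) r"
| groupcast_undef: "eval_ips T \<xi> dests = None \<or> eval_msg T \<xi> ms = None \<Longrightarrow>
    r = Prefix (Groupcast dests ms) p \<Longrightarrow> seq_step T \<xi> r (AWait W) (tick T \<xi>) r"
| unicast_undef: "eval_ip T \<xi> dest = None \<or> eval_msg T \<xi> ms = None \<Longrightarrow>
    r = Unicast dest ms p q \<Longrightarrow> seq_step T \<xi> r (AWait W) (tick T \<xi>) r"
| send_undef: "eval_msg T \<xi> ms = None \<Longrightarrow> r = Prefix (Send ms) p \<Longrightarrow>
    seq_step T \<xi> r (AWait W) (tick T \<xi>) r"
| deliver_undef: "eval_data T \<xi> data = None \<Longrightarrow> r = Prefix (Deliver data) p \<Longrightarrow>
    seq_step T \<xi> r (AWait W) (tick T \<xi>) r"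
| assign_undef: "eval T \<xi> e = None \<Longrightarrow> r = Assign x e p \<Longrightarrow>
    seq_step T \<xi> r (AWait W) (tick T \<xi>) r"
| call_undef: "\<exists>e \<in> set es. eval T \<xi> e = None \<Longrightarrow> r = Call X es \<Longrightarrow>
    seq_step T \<xi> r (AWait W) (tick T \<xi>) r"

| call: "map (eval T \<xi>) es = map Some vs \<Longrightarrow> length vs = length (params T X) \<Longrightarrow>
    seq_step T (Map.empty(params T X [\<mapsto>] vs)) (body T X) a \<zeta> p' \<Longrightarrow> a \<notin> range AWait \<Longrightarrow>
    seq_step T \<xi> (Call X es) a \<zeta> p'"
| call_wait: "map (eval T \<xi>) es = map Some vs \<Longrightarrow> length vs = length (params T X) \<Longrightarrow>
    seq_step T (Map.empty(params T X [\<mapsto>] vs)) (body T X) (AWait w) \<zeta> p' \<Longrightarrow>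
    seq_step T \<xi> (Call X es) (AWait w) (tick T \<xi>) (Call X es)"

| guard: "guard_extension T \<xi> \<phi> \<zeta> \<Longrightarrow> seq_step T \<xi> (Guard \<phi> p) Tau \<zeta> p"
| guard_wait: "\<nexists>\<zeta>. guard_extension T \<xi> \<phi> \<zeta> \<Longrightarrow>
    seq_step T \<xi> (Guard \<phi> p) (AWait W) (tick T \<xi>) (Guard \<phi> p)"

| choice_left: "seq_step T \<xi> p a \<zeta> p' \<Longrightarrow> a \<notin> range AWait \<Longrightarrow> seq_step T \<xi> (Choice p q) a \<zeta> p'"
| choice_right: "seq_step T \<xi> p a \<zeta> p' \<Longrightarrow> a \<notin> range AWait \<Longrightarrow> seq_step T \<xi> (Choice q p) a \<zeta> p'"
| choice_wait: "seq_step T \<xi> p (AWait w1) \<zeta> p' \<Longrightarrow> seq_step T \<xi> q (AWait w2) \<zeta> q' \<Longrightarrow>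
    seq_step T \<xi> (Choice p q) (AWait (wait_join w1 w2)) \<zeta> (Choice p' q')"


section \<open>Parallel processes\<close>

datatype ('x, 'f, 'p, 'd, 'm, 'i, 'o, 'n) pp =
    Seq "('x, 'd, 'm, 'i, 'o) valuation" "('x, 'f, 'p, 'm, 'i, 'n) sp"
  | Par "('x, 'f, 'p, 'd, 'm, 'i, 'o, 'n) pp" "('x, 'f, 'p, 'd, 'm, 'i, 'o, 'n) pp"

fun wait_par :: "wait \<Rightarrow> wait \<Rightarrow> wait option" where
  "wait_par W W = Some W"
| "wait_par W WR = Some WR"
| "wait_par W WS = Some W"
| "wait_par W WRS = Some WR"
| "wait_par WR W = Some W"
| "wait_par WR WR = Some WR"
| "wait_par WR WS = None"
| "wait_par WR WRS = None"
| "wait_par WS W = Some WS"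
| "wait_par WS WR = Some WRS"
| "wait_par WS WS = Some WS"
| "wait_par WS WRS = Some WRS"
| "wait_par WRS W = Some WS"
| "wait_par WRS WR = Some WRS"
| "wait_par WRS WS = None"
| "wait_par WRS WRS = None"

definition timed :: "('d, 'm, 'i) action \<Rightarrow> bool" where
  "timed a \<longleftrightarrow> a \<in> range AWait \<or> (\<exists>R w. a = ATrans R w)"

inductive par_step ::
  "('x, 'f, 'p, 's, 'd, 'm, 'i, 'o, 'n) tawn \<Rightarrow>
   ('x, 'f, 'p, 'd, 'm, 'i, 'o, 'n) pp \<Rightarrow> ('d, 'm, 'i) action \<Rightarrow>
   ('x, 'f, 'p, 'd, 'm, 'i, 'o, 'n) pp \<Rightarrow> bool"
  for T
where
  seq: "seq_step T \<xi> p a \<zeta> p' \<Longrightarrow> par_step T (Seq \<xi> p) a (Seq \<zeta> p')"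
| left: "par_step T P a P' \<Longrightarrow> a \<notin> range AReceive \<Longrightarrow> \<not> timed a \<Longrightarrow>
    par_step T (Par P Q) a (Par P' Q)"
| right: "par_step T Q a Q' \<Longrightarrow> a \<notin> range ASend \<Longrightarrow> \<not> timed a \<Longrightarrow>
    par_step T (Par P Q) a (Par P Q')"
| comm: "par_step T P (AReceive m) P' \<Longrightarrow> par_step T Q (ASend m) Q' \<Longrightarrow>
    par_step T (Par P Q) Tau (Par P' Q')"
| wait_wait: "par_step T P (AWait w1) P' \<Longrightarrow> par_step T Q (AWait w2) Q' \<Longrightarrow>
    wait_par w1 w2 = Some w3 \<Longrightarrow> par_step T (Par P Q) (AWait w3) (Par P' Q')"
| trans_wait: "par_step T P (ATrans R w1) P' \<Longrightarrow> par_step T Q (AWait w2) Q' \<Longrightarrow>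
    wait_par w1 w2 = Some w3 \<Longrightarrow> par_step T (Par P Q) (ATrans R w3) (Par P' Q')"
| wait_trans: "par_step T P (AWait w1) P' \<Longrightarrow> par_step T Q (ATrans R w2) Q' \<Longrightarrow>
    wait_par w1 w2 = Some w3 \<Longrightarrow> par_step T (Par P Q) (ATrans R w3) (Par P' Q')"
| trans_trans: "par_step T P (ATrans R w1) P' \<Longrightarrow> par_step T Q (ATrans R w2) Q' \<Longrightarrow>
    wait_par w1 w2 = Some w3 \<Longrightarrow> par_step T (Par P Q) (ATrans R w3) (Par P' Q')"


section \<open>Well-formedness\<close>

primrec wf_prefix ::
  "('x, 'f, 'p, 's, 'd, 'm, 'i, 'o, 'z) data_structure_scheme \<Rightarrow>
   ('x, 'f) action_prefix \<Rightarrow> bool"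
where
  "wf_prefix T (Broadcast ms) \<longleftrightarrow> has_sort T ms MSG"
| "wf_prefix T (Groupcast dests ms) \<longleftrightarrow> has_sort T dests IPS \<and> has_sort T ms MSG"
| "wf_prefix T (Send ms) \<longleftrightarrow> has_sort T ms MSG"
| "wf_prefix T (Deliver data) \<longleftrightarrow> has_sort T data DATA"
| "wf_prefix T (Receive x) \<longleftrightarrow> var_sort T x = MSG"

primrec wf_sp ::
  "('x, 'f, 'p, 's, 'd, 'm, 'i, 'o, 'n) tawn \<Rightarrow> ('x, 'f, 'p, 'm, 'i, 'n) sp \<Rightarrow> bool"
where
  "wf_sp T (Call X es) \<longleftrightarrow> list_all2 (has_sort T) es (map (var_sort T) (params T X))"
| "wf_sp T (Guard \<phi> p) \<longleftrightarrow> wf_form T \<phi> \<and> wf_sp T p"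
| "wf_sp T (Assign x e p) \<longleftrightarrow> has_sort T e (var_sort T x) \<and> wf_sp T p"
| "wf_sp T (Choice p q) \<longleftrightarrow> wf_sp T p \<and> wf_sp T q"
| "wf_sp T (Prefix \<alpha> p) \<longleftrightarrow> wf_prefix T \<alpha> \<and> wf_sp T p"
| "wf_sp T (Unicast dest ms p q) \<longleftrightarrow>
     has_sort T dest IP \<and> has_sort T ms MSG \<and> wf_sp T p \<and> wf_sp T q"
| "wf_sp T (Cast dsts m n l p q) \<longleftrightarrow> wf_sp T p \<and> wf_sp T q"

primrec guarded :: "('x, 'f, 'p, 'm, 'i, 'n) sp \<Rightarrow> bool" where
  "guarded (Call X es) \<longleftrightarrow> False"
| "guarded (Guard \<phi> p) \<longleftrightarrow> True"
| "guarded (Assign x e p) \<longleftrightarrow> True"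
| "guarded (Choice p q) \<longleftrightarrow> guarded p \<and> guarded q"
| "guarded (Prefix \<alpha> p) \<longleftrightarrow> True"
| "guarded (Unicast dest ms p q) \<longleftrightarrow> True"
| "guarded (Cast dsts m n l p q) \<longleftrightarrow> guarded p \<and> guarded q"

text \<open>That \<open>Cast\<close> never occurs inside a sum has to be read up to unfolding of process names:
  with \<open>X\<close> defined as a \<open>Cast\<close> expression, the sum \<open>Choice (Call X []) q\<close> behaves as one
  with a \<open>Cast\<close> summand.\<close>

inductive contains_cast ::
  "('x, 'f, 'p, 's, 'd, 'm, 'i, 'o, 'n) tawn \<Rightarrow> ('x, 'f, 'p, 'm, 'i, 'n) sp \<Rightarrow> bool"
  for T
where
  "contains_cast T (Cast dsts m n l p q)"
| "contains_cast T (body T X) \<Longrightarrow> contains_cast T (Call X es)"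
| "contains_cast T p \<Longrightarrow> contains_cast T (Guard \<phi> p)"
| "contains_cast T p \<Longrightarrow> contains_cast T (Assign x e p)"
| "contains_cast T p \<Longrightarrow> contains_cast T (Choice p q)"
| "contains_cast T q \<Longrightarrow> contains_cast T (Choice p q)"
| "contains_cast T p \<Longrightarrow> contains_cast T (Prefix \<alpha> p)"
| "contains_cast T p \<Longrightarrow> contains_cast T (Unicast dest ms p q)"
| "contains_cast T q \<Longrightarrow> contains_cast T (Unicast dest ms p q)"

primrec no_cast_in_sum ::
  "('x, 'f, 'p, 's, 'd, 'm, 'i, 'o, 'n) tawn \<Rightarrow> ('x, 'f, 'p, 'm, 'i, 'n) sp \<Rightarrow> bool"
where
  "no_cast_in_sum T (Call X es) \<longleftrightarrow> True"
| "no_cast_in_sum T (Guard \<phi> p) \<longleftrightarrow> no_cast_in_sum T p"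
| "no_cast_in_sum T (Assign x e p) \<longleftrightarrow> no_cast_in_sum T p"
| "no_cast_in_sum T (Choice p q) \<longleftrightarrow> \<not> contains_cast T p \<and> \<not> contains_cast T q"
| "no_cast_in_sum T (Prefix \<alpha> p) \<longleftrightarrow> no_cast_in_sum T p"
| "no_cast_in_sum T (Unicast dest ms p q) \<longleftrightarrow> no_cast_in_sum T p \<and> no_cast_in_sum T q"
| "no_cast_in_sum T (Cast dsts m n l p q) \<longleftrightarrow> no_cast_in_sum T p \<and> no_cast_in_sum T q"

definition wf_tawn :: "('x, 'f, 'p, 's, 'd, 'm, 'i, 'o, 'n) tawn \<Rightarrow> bool" where
  "wf_tawn T \<longleftrightarrow> wf_data T \<and> LB T > 0 \<and> LG T > 0 \<and> LU T > 0 \<and>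
     (\<forall>X. distinct (params T X) \<and> wf_sp T (body T X) \<and>
          guarded (body T X) \<and> no_cast_in_sum T (body T X))"

primrec wf_pp ::
  "('x, 'f, 'p, 's, 'd, 'm, 'i, 'o, 'n) tawn \<Rightarrow>
   ('x, 'f, 'p, 'd, 'm, 'i, 'o, 'n) pp \<Rightarrow> bool"
where
  "wf_pp T (Seq \<xi> p) \<longleftrightarrow> wf_valuation T \<xi> \<and> wf_sp T p \<and> no_cast_in_sum T p"
| "wf_pp T (Par P Q) \<longleftrightarrow> wf_pp T P \<and> wf_pp T Q"


section \<open>Enabled actions\<close>

definition enabled ::
  "('x, 'f, 'p, 's, 'd, 'm, 'i, 'o, 'n) tawn \<Rightarrow>
   ('x, 'f, 'p, 'd, 'm, 'i, 'o, 'n) pp \<Rightarrow> ('d, 'm, 'i) action \<Rightarrow> bool"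
where
  "enabled T P a \<longleftrightarrow> (\<exists>P'. par_step T P a P')"

definition enabled_rcv where
  "enabled_rcv T P \<longleftrightarrow> (\<exists>m. enabled T P (AReceive m))"

definition enabled_send where
  "enabled_send T P \<longleftrightarrow> (\<exists>m. enabled T P (ASend m))"

definition enabled_inb where
  "enabled_inb T P \<longleftrightarrow>
     (\<exists>R m. enabled T P (ACast R m)) \<or> (\<exists>d. enabled T P (ADeliver d)) \<or> enabled T P Tau"

end

theory Submission
  imports Defs
begin

text \<open>A sequential or parallel state waits in exactly one way, namely the one recording which of
  receiving and sending it offers, and only if nothing instantaneous is enabled. Two uniformity
  properties make this invariant under parallel composition: a state that can receive some message
  can receive every message, so that an undefined combination of wait actions entails a
  synchronisation, and a state that can transmit to some set can transmit to every set with the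
  same wait action, so that the sets of two transmitting components can be made to agree.
  Guardedness reduces process calls to sums of expressions that show their first action.\<close>

text \<open>The predicates here take an arbitrary set \<open>en\<close> of enabled actions, so that
  sequential states (\<open>seq_enabled\<close>) and parallel states (\<open>enabled\<close>) share
  them.\<close>

definition inb_action :: "(('d, 'm, 'i) action \<Rightarrow> bool) \<Rightarrow> bool" where
  "inb_action en \<longleftrightarrow> (\<exists>R m. en (ACast R m)) \<or> (\<exists>d. en (ADeliver d)) \<or> en Tau"

definition waits :: "(('d, 'm, 'i) action \<Rightarrow> bool) \<Rightarrow> wait \<Rightarrow> bool" where
  "waits en w \<longleftrightarrow> en (AWait w) \<or> (\<exists>R. en (ATrans R w))"

definition wait_kind :: "bool \<Rightarrow> bool \<Rightarrow> wait" where
  "wait_kind r s = (if r then if s then WRS else WR else if s then WS else W)"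

text \<open>The last conjunct packs the four equivalences of the theorem into one; the first two
  strengthen it so that it survives parallel composition.\<close>

definition regular :: "(('d, 'm, 'i) action \<Rightarrow> bool) \<Rightarrow> bool" where
  "regular en \<longleftrightarrow>
     (\<forall>m m'. en (AReceive m) \<longrightarrow> en (AReceive m')) \<and>
     (\<forall>R R' w. en (ATrans R w) \<longrightarrow> en (ATrans R' w)) \<and>
     (\<forall>w. waits en w \<longleftrightarrow>
        \<not> inb_action en \<and> w = wait_kind (\<exists>m. en (AReceive m)) (\<exists>m. en (ASend m)))"

section \<open>Sequential states\<close>

definition seq_enabled ::
  "('x, 'f, 'p, 's, 'd, 'm, 'i, 'o, 'n) tawn \<Rightarrow> ('x, 'd, 'm, 'i, 'o) valuation \<Rightarrow>
   ('x, 'f, 'p, 'm, 'i, 'n) sp \<Rightarrow> ('d, 'm, 'i) action \<Rightarrow> bool"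
where
  "seq_enabled T \<xi> p a \<longleftrightarrow> (\<exists>\<zeta> p'. seq_step T \<xi> p a \<zeta> p')"

text \<open>The rule \<open>choice_wait\<close> asks both summands to reach the same valuation.
  Waiting only advances the clock, so they always do.\<close>

lemma wait_step:
  assumes "seq_step T \<xi> p a \<zeta> p'" "a = AWait w"
  shows "\<zeta> = tick T \<xi>"
  using assms by (induction arbitrary: w rule: seq_step.induct) auto

lemma contains_cast_if_trans:
  assumes "seq_step T \<xi> p a \<zeta> p'" "a = ATrans R w"
  shows "contains_cast T p"
  using assms by (induction rule: seq_step.induct) (auto intro: contains_cast.intros)

text \<open>At a sum, \<open>no_cast_in_sum\<close> does not recurse into the summands but forbids
  casts in them altogether. This lemma recovers the property for the summands in the induction of
  \<open>regular_seq_aux\<close>.\<close>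

lemma no_cast_in_sum_if_no_cast: "\<not> contains_cast T p \<Longrightarrow> no_cast_in_sum T p"
  by (induction p) (auto intro: contains_cast.intros)

inductive_simps seq_step_simps:
  "seq_step T \<xi> (Prefix (Broadcast ms) p) a \<zeta> p'"
  "seq_step T \<xi> (Prefix (Groupcast ds ms) p) a \<zeta> p'"
  "seq_step T \<xi> (Prefix (Send ms) p) a \<zeta> p'"
  "seq_step T \<xi> (Prefix (Deliver e) p) a \<zeta> p'"
  "seq_step T \<xi> (Prefix (Receive x) p) a \<zeta> p'"
  "seq_step T \<xi> (Unicast dest ms p q) a \<zeta> p'"
  "seq_step T \<xi> (Assign x e p) a \<zeta> p'"
  "seq_step T \<xi> (Guard \<phi> p) a \<zeta> p'"
  "seq_step T \<xi> (Cast I m 0 l p q) a \<zeta> p'"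
  "seq_step T \<xi> (Cast I m (Suc n) l p q) a \<zeta> p'"
  "seq_step T \<xi> (Choice p q) a \<zeta> p'"
  "seq_step T \<xi> (Call X es) a \<zeta> p'"

inductive_simps par_step_simps:
  "par_step T (Seq \<xi> p) a P'"
  "par_step T (Par P Q) a P'"

text \<open>The right-hand sides are written so that each branch is literally one of the seven
  predicates of \<open>regular_simple\<close>.\<close>

lemma seq_enabled_simps:
  "seq_enabled T \<xi> (Prefix (Broadcast ms) p) =
     (if eval_msg T \<xi> ms = None then (\<lambda>a. a = AWait W) else (\<lambda>a. a = Tau))"
  "seq_enabled T \<xi> (Prefix (Groupcast ds ms) p) =
     (if eval_ips T \<xi> ds = None \<or> eval_msg T \<xi> ms = None then (\<lambda>a. a = AWait W)
      else (\<lambda>a. a = Tau))"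
  "seq_enabled T \<xi> (Unicast dest ms p q) =
     (if eval_ip T \<xi> dest = None \<or> eval_msg T \<xi> ms = None then (\<lambda>a. a = AWait W)
      else (\<lambda>a. a = Tau))"
  "seq_enabled T \<xi> (Prefix (Send ms) p) =
     (case eval_msg T \<xi> ms of None \<Rightarrow> \<lambda>a. a = AWait W
      | Some m \<Rightarrow> \<lambda>a. a = ASend m \<or> a = AWait WS)"
  "seq_enabled T \<xi> (Prefix (Deliver e) p) =
     (case eval_data T \<xi> e of None \<Rightarrow> \<lambda>a. a = AWait W
      | Some d \<Rightarrow> \<lambda>a. a = ADeliver d)"
  "seq_enabled T \<xi> (Prefix (Receive x) p) = (\<lambda>a. a \<in> range AReceive \<or> a = AWait WR)"
  "seq_enabled T \<xi> (Assign x e p) =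
     (if eval T \<xi> e = None then (\<lambda>a. a = AWait W) else (\<lambda>a. a = Tau))"
  "seq_enabled T \<xi> (Guard \<phi> p) =
     (if \<exists>\<zeta>. guard_extension T \<xi> \<phi> \<zeta> then (\<lambda>a. a = Tau) else (\<lambda>a. a = AWait W))"
  "seq_enabled T \<xi> (Cast I m 0 l p q) = (\<lambda>a. a = ACast I m)"
  "seq_enabled T \<xi> (Cast I m (Suc n) l p q) = (\<lambda>a. \<exists>R. a = ATrans R W)"
  unfolding seq_enabled_def seq_step_simps
  by (rule ext; auto split: option.splits)+

lemma seq_enabled_choice:
  "a \<notin> range AWait \<Longrightarrow>
     seq_enabled T \<xi> (Choice p q) a \<longleftrightarrow> seq_enabled T \<xi> p a \<or> seq_enabled T \<xi> q a"
  unfolding seq_enabled_def seq_step_simps by blast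

lemma seq_enabled_choice_wait:
  "seq_enabled T \<xi> (Choice p q) (AWait w) \<longleftrightarrow>
     (\<exists>w1 w2. seq_enabled T \<xi> p (AWait w1) \<and> seq_enabled T \<xi> q (AWait w2) \<and> w = wait_join w1 w2)"
  (is "?l \<longleftrightarrow> ?r")
proof
  show "?l \<Longrightarrow> ?r"
    unfolding seq_enabled_def seq_step_simps by auto
  show "?r \<Longrightarrow> ?l"
    unfolding seq_enabled_def by (metis seq_step.choice_wait wait_step)
qed

text \<open>After a wait the call stays folded whereas its body may have moved, but enabledness
  ignores the target state, so the two agree on all actions.\<close>

lemma seq_enabled_call:
  assumes "map (eval T \<xi>) es = map Some vs" "length vs = length (params T X)"
  shows "seq_enabled T \<xi> (Call X es) a \<longleftrightarrow>
           seq_enabled T (Map.empty(params T X [\<mapsto>] vs)) (body T X) a"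
proof -
  \<comment> \<open>The call rules choose their own list of argument values; injectivity of
    \<open>Some\<close> forces it to be \<open>vs\<close>.\<close>
  have inj: "vs' = vs" if "map (eval T \<xi>) es = map Some vs'" for vs'
    using that assms(1) by (simp add: inj_map_eq_map)
  have "eval T \<xi> e \<noteq> None" if "e \<in> set es" for e
    using assms(1) that by (metis imageE image_set option.distinct(1) rev_image_eqI)
  then have "seq_enabled T \<xi> (Call X es) a \<Longrightarrow>
      seq_enabled T (Map.empty(params T X [\<mapsto>] vs)) (body T X) a"
    unfolding seq_enabled_def seq_step_simps by (blast dest: inj)
  moreover have "seq_enabled T (Map.empty(params T X [\<mapsto>] vs)) (body T X) a \<Longrightarrow>
      seq_enabled T \<xi> (Call X es) a"
    unfolding seq_enabled_def using seq_step.call[OF assms] seq_step.call_wait[OF assms] by blast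
  ultimately show ?thesis
    by blast
qed

lemma seq_enabled_call_undef:
  assumes "\<exists>e \<in> set es. eval T \<xi> e = None"
  shows "seq_enabled T \<xi> (Call X es) = (\<lambda>a. a = AWait W)"
proof -
  have "map (eval T \<xi>) es \<noteq> map Some vs" for vs
    using assms by (metis imageE image_set option.distinct(1) rev_image_eqI)
  then show ?thesis
    unfolding seq_enabled_def seq_step_simps using assms by (intro ext) auto
qed

text \<open>With wait actions coded by two Booleans for receiving and sending, the join is
  componentwise disjunction, which is how the offers of two summands combine.\<close>

lemma wait_join_wait_kind:
  "wait_join (wait_kind r s) (wait_kind r' s') = wait_kind (r \<or> r') (s \<or> s')"
  by (simp add: wait_kind_def wait_join_def)

lemma regular_choice:
  assumes "regular (seq_enabled T \<xi> p)" "regular (seq_enabled T \<xi> q)"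
    and "\<not> contains_cast T p" "\<not> contains_cast T q"
  shows "regular (seq_enabled T \<xi> (Choice p q))"
proof -
  let ?en = "seq_enabled T \<xi>"
  let ?r = "\<lambda>p. \<exists>m. ?en p (AReceive m)" and ?s = "\<lambda>p. \<exists>m. ?en p (ASend m)"
  \<comment> \<open>Transmissions stem from casts only. By \<open>choice_left\<close> and
    \<open>choice_right\<close>, a transmission of one summand would be possible in the sum even
    when the other summand has an instantaneous action, which would break regularity.\<close>
  have no_trans: "\<not> ?en p (ATrans R w)" "\<not> ?en q (ATrans R w)" for R w
    using assms(3,4) contains_cast_if_trans unfolding seq_enabled_def by blast+
  have choice: "?en (Choice p q) a \<longleftrightarrow> ?en p a \<or> ?en q a" if "\<forall>w. a \<noteq> AWait w" for a
    using that seq_enabled_choice by blast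
  have waits: "waits (?en p) w \<longleftrightarrow> \<not> inb_action (?en p) \<and> w = wait_kind (?r p) (?s p)"
    "waits (?en q) w \<longleftrightarrow> \<not> inb_action (?en q) \<and> w = wait_kind (?r q) (?s q)" for w
    using assms(1,2) unfolding regular_def by blast+
  have inb: "inb_action (?en (Choice p q)) \<longleftrightarrow> inb_action (?en p) \<or> inb_action (?en q)"
    unfolding inb_action_def by (auto simp: choice)
  have "waits (?en (Choice p q)) w \<longleftrightarrow>
      (\<exists>w1 w2. waits (?en p) w1 \<and> waits (?en q) w2 \<and> w = wait_join w1 w2)" for w
    unfolding waits_def by (simp add: choice no_trans seq_enabled_choice_wait)
  then have "waits (?en (Choice p q)) w \<longleftrightarrow> \<not> inb_action (?en (Choice p q)) \<and>
      w = wait_kind (?r p \<or> ?r q) (?s p \<or> ?s q)" for w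
    by (auto simp: waits inb wait_join_wait_kind)
  moreover have "?r (Choice p q) \<longleftrightarrow> ?r p \<or> ?r q" "?s (Choice p q) \<longleftrightarrow> ?s p \<or> ?s q"
    by (auto simp: choice)
  moreover have "?en (Choice p q) (AReceive m) \<Longrightarrow> ?en (Choice p q) (AReceive m')" for m m'
    using assms(1,2) choice[of "AReceive m"] choice[of "AReceive m'"]
    unfolding regular_def by blast
  ultimately show ?thesis
    unfolding regular_def by (simp add: choice no_trans)
qed

lemma regular_simple:
  "regular (\<lambda>a. a = AWait W)"
  "regular (\<lambda>a. a = Tau)"
  "regular (\<lambda>a. a = ADeliver d)"
  "regular (\<lambda>a. a = ACast I m)"
  "regular (\<lambda>a. a = ASend m \<or> a = AWait WS)"
  "regular (\<lambda>a. a \<in> range AReceive \<or> a = AWait WR)"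
  "regular (\<lambda>a. \<exists>R. a = ATrans R W)"
  unfolding regular_def waits_def inb_action_def wait_kind_def by (auto simp: image_iff)

text \<open>The disjunctive assumption avoids a circular argument about recursion. The lemma is
  applied first to guarded bodies, which yields regularity of calls, and then to arbitrary
  expressions with that result at hand. Only sums use the induction hypotheses.\<close>

lemma regular_seq_aux:
  assumes "wf_sp T p" "no_cast_in_sum T p"
    and "guarded p \<or> (\<forall>\<xi> X es. wf_sp T (Call X es) \<longrightarrow> regular (seq_enabled T \<xi> (Call X es)))"
  shows "regular (seq_enabled T \<xi> p)"
  using assms
proof (induction p)
  case (Call X es)
  then show ?case
    by simp
next
  case (Choice p q)
  then show ?case
    by (intro regular_choice) (auto intro: no_cast_in_sum_if_no_cast)
next
  case (Prefix \<alpha> p)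
  show ?case
    by (cases \<alpha>) (simp_all add: seq_enabled_simps regular_simple split: option.split)
next
  case (Cast I m n l p q)
  show ?case
    by (cases n) (simp_all add: seq_enabled_simps regular_simple)
qed (simp_all add: seq_enabled_simps regular_simple)

lemma regular_call:
  assumes "wf_tawn T" "wf_sp T (Call X es)"
  shows "regular (seq_enabled T \<xi> (Call X es))"
proof (cases "\<exists>e \<in> set es. eval T \<xi> e = None")
  case True
  then show ?thesis
    by (simp add: seq_enabled_call_undef regular_simple)
next
  case False
  \<comment> \<open>All arguments are defined in this case, so \<open>the\<close> never meets
    \<open>None\<close>; the arity comes from well-sortedness of the call.\<close>
  define vs where "vs = map (the \<circ> eval T \<xi>) es"
  have "map (eval T \<xi>) es = map Some vs" "length vs = length (params T X)"
    using False assms(2) by (auto simp: vs_def dest: list_all2_lengthD)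
  then have "seq_enabled T \<xi> (Call X es) =
      seq_enabled T (Map.empty(params T X [\<mapsto>] vs)) (body T X)"
    by (intro ext seq_enabled_call)
  moreover have "wf_sp T (body T X)" "no_cast_in_sum T (body T X)" "guarded (body T X)"
    using assms(1) unfolding wf_tawn_def by blast+
  ultimately show ?thesis
    using regular_seq_aux by metis
qed

lemma regular_seq:
  assumes "wf_tawn T" "wf_sp T p" "no_cast_in_sum T p"
  shows "regular (seq_enabled T \<xi> p)"
  using assms(2,3) by (rule regular_seq_aux) (simp add: regular_call[OF assms(1)])

section \<open>Parallel states\<close>

lemma enabled_Seq: "enabled T (Seq \<xi> p) = seq_enabled T \<xi> p"
  unfolding enabled_def seq_enabled_def fun_eq_iff par_step_simps by blast

lemma enabled_Par:
  "enabled T (Par P Q) (AReceive m) \<longleftrightarrow> enabled T Q (AReceive m)"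
  "enabled T (Par P Q) (ASend m) \<longleftrightarrow> enabled T P (ASend m)"
  "enabled T (Par P Q) (ADeliver d) \<longleftrightarrow> enabled T P (ADeliver d) \<or> enabled T Q (ADeliver d)"
  "enabled T (Par P Q) (ACast R m) \<longleftrightarrow> enabled T P (ACast R m) \<or> enabled T Q (ACast R m)"
  "enabled T (Par P Q) Tau \<longleftrightarrow> enabled T P Tau \<or> enabled T Q Tau \<or>
     (\<exists>m. enabled T P (AReceive m) \<and> enabled T Q (ASend m))"
  "enabled T (Par P Q) (AWait w) \<longleftrightarrow>
     (\<exists>w1 w2. wait_par w1 w2 = Some w \<and> enabled T P (AWait w1) \<and> enabled T Q (AWait w2))"
  "enabled T (Par P Q) (ATrans R w) \<longleftrightarrow>
     (\<exists>w1 w2. wait_par w1 w2 = Some w \<and>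
        (enabled T P (ATrans R w1) \<and> enabled T Q (AWait w2) \<or>
         enabled T P (AWait w1) \<and> enabled T Q (ATrans R w2) \<or>
         enabled T P (ATrans R w1) \<and> enabled T Q (ATrans R w2)))"
  unfolding enabled_def par_step_simps by (simp_all add: timed_def image_iff ex_disj_distrib) blast+

lemma waits_Par:
  assumes "regular (enabled T P)" "regular (enabled T Q)"
  shows "waits (enabled T (Par P Q)) w \<longleftrightarrow>
    (\<exists>w1 w2. wait_par w1 w2 = Some w \<and> waits (enabled T P) w1 \<and> waits (enabled T Q) w2)"
proof -
  \<comment> \<open>Uniformity makes the set \<open>R\<close> irrelevant, and \<open>{}\<close>
    serves as a sample. With \<open>R\<close> gone, any two ways of waiting on the two sides, by
    wait or by transmission, fit one of the four timed rules.\<close>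
  have "\<exists>t. \<forall>R w. enabled T S (ATrans R w) = t w" if "regular (enabled T S)" for S
    using that unfolding regular_def by (intro exI[of _ "\<lambda>w. enabled T S (ATrans {} w)"]) blast
  then obtain t u where
    "\<And>R w. enabled T P (ATrans R w) = t w" "\<And>R w. enabled T Q (ATrans R w) = u w"
    using assms by metis
  then show ?thesis
    unfolding waits_def enabled_Par by auto
qed

text \<open>The table in Boolean form: the composition receives through its right component and
  sends through its left one. It is undefined exactly when the left can receive and the right can
  send.\<close>

lemma wait_par_wait_kind:
  "wait_par (wait_kind r s) (wait_kind r' s') =
     (if r \<and> s' then None else Some (wait_kind r' s))"
  by (simp add: wait_kind_def)

lemma regular_Par:
  assumes P: "regular (enabled T P)" and Q: "regular (enabled T Q)"
  shows "regular (enabled T (Par P Q))"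
proof -
  let ?r = "\<lambda>S. \<exists>m. enabled T S (AReceive m)" and ?s = "\<lambda>S. \<exists>m. enabled T S (ASend m)"
  have waits: "waits (enabled T S) w \<longleftrightarrow>
      \<not> inb_action (enabled T S) \<and> w = wait_kind (?r S) (?s S)" if "S = P \<or> S = Q" for S w
    using assms that unfolding regular_def by blast
  \<comment> \<open>Synchronisation needs a common message. Since \<open>P\<close> receives every
    message once it receives any, some reception of \<open>P\<close> and some send of
    \<open>Q\<close> already suffice.\<close>
  have inb: "inb_action (enabled T (Par P Q)) \<longleftrightarrow>
      inb_action (enabled T P) \<or> inb_action (enabled T Q) \<or> ?r P \<and> ?s Q"
    using P unfolding regular_def inb_action_def enabled_Par by blast
  have "waits (enabled T (Par P Q)) w \<longleftrightarrow> \<not> inb_action (enabled T P) \<and>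
      \<not> inb_action (enabled T Q) \<and>
      wait_par (wait_kind (?r P) (?s P)) (wait_kind (?r Q) (?s Q)) = Some w" for w
    by (auto simp: waits_Par[OF assms] waits)
  \<comment> \<open>The case where \<open>wait_par\<close> is undefined is precisely the extra
    synchronisation disjunct in \<open>inb\<close>.\<close>
  then have "waits (enabled T (Par P Q)) w \<longleftrightarrow>
      \<not> inb_action (enabled T (Par P Q)) \<and> w = wait_kind (?r Q) (?s P)" for w
    unfolding inb wait_par_wait_kind by auto
  moreover have "enabled T (Par P Q) (AReceive m) \<Longrightarrow> enabled T (Par P Q) (AReceive m')" for m m'
    using Q unfolding regular_def enabled_Par by blast
  moreover have "enabled T (Par P Q) (ATrans R w) \<Longrightarrow> enabled T (Par P Q) (ATrans R' w)" for R R' w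
    using P Q unfolding regular_def enabled_Par by meson
  ultimately show ?thesis
    unfolding regular_def enabled_Par(1,2) by blast
qed

lemma regular_enabled:
  assumes "wf_tawn T" "wf_pp T P"
  shows "regular (enabled T P)"
  using assms(2)
proof (induction P)
  case (Seq \<xi> p)
  then show ?case
    by (simp add: enabled_Seq regular_seq[OF assms(1)])
next
  case (Par P Q)
  then show ?case
    by (simp add: regular_Par)
qed

theorem theorem2:
  fixes T :: "('x, 'f, 'p, 's, 'd, 'm, 'i, 'o, 'n) tawn"
    and P :: "('x, 'f, 'p, 'd, 'm, 'i, 'o, 'n) pp"
  assumes "wf_tawn T" and "wf_pp T P"
  shows "(enabled T P (AWait W) \<or> (\<exists>R. enabled T P (ATrans R W)) \<longleftrightarrow>
            \<not> enabled_rcv T P \<and> \<not> enabled_send T P \<and> \<not> enabled_inb T P) \<and>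
         (enabled T P (AWait WR) \<or> (\<exists>R. enabled T P (ATrans R WR)) \<longleftrightarrow>
            enabled_rcv T P \<and> \<not> enabled_send T P \<and> \<not> enabled_inb T P) \<and>
         (enabled T P (AWait WS) \<or> (\<exists>R. enabled T P (ATrans R WS)) \<longleftrightarrow>
            \<not> enabled_rcv T P \<and> enabled_send T P \<and> \<not> enabled_inb T P) \<and>
         (enabled T P (AWait WRS) \<or> (\<exists>R. enabled T P (ATrans R WRS)) \<longleftrightarrow>
            enabled_rcv T P \<and> enabled_send T P \<and> \<not> enabled_inb T P)"
  \<comment> \<open>The four equivalences are the instances of the last conjunct of
    \<open>regular\<close> at the four wait actions.\<close>
  using regular_enabled[OF assms]
  unfolding regular_def waits_def inb_action_def enabled_rcv_def enabled_send_def enabled_inb_def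
  by (simp add: wait_kind_def)

end
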